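(* Let $r_p,h_p,r_v,a_{lo},a_{up},a_{max},\epsilon$ be real parameters and $r,h,v,w,v_{lo},v_{up},t$ real state variables. The following differential game logic formula is valid: $$\Big(r_p\ge0\wedge h_p>0\wedge r_v\ge0\wedge a_{lo}>0\wedge(w=-1\vee w=1)\wedge a_{up}>a_{lo}\wedge a_{max}\ge a_{lo}\wedge C^{\epsilon}_{impl}(r,h,v,w,v_{lo},v_{up})\Big)\to[\alpha_4^*]\big(|r|>r_p\vee|h|>h_p\big),$$ where $$\alpha_4\equiv(w:=1\cup w:=-1);\ v_{lo}:=*;\ v_{up}:=*;\ ?C^{\epsilon}_{impl}(r,h,v,w,v_{lo},v_{up});\ \mathit{adv}:=(w,v_{lo},v_{up});\ t:=0;\ \Big(\big(a_o:=*;\ ?(-a_{max}\le a_o\le a_{max})\big)^d;\ \{r'=-r_v,h'=-v,v'=a_o,t'=1\ \&\ (t\le\epsilon\vee\epsilon<0)\wedge((wa_o\le0\vee wv\le wv_{up})\cup(wa_o\ge0\wedge wv\ge wv_{up}))\}\Big)^*.$$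
   Context: Game semantics (differential game logic dGL). A hybrid game is played between the ownship (the player who must establish the postcondition) and the opponent. $P\to[\alpha]Q$ is valid iff from every state satisfying $P$ the ownship has a strategy in $\alpha$ such that every play it allows ends (whenever it ends) in a state satisfying $Q$. Constructs: $x:=e$ assigns; $x:=*$ opponent picks any real value; $?\phi$ test: if false the opponent loses; $\alpha;\beta$ sequential; $\alpha\cup\beta$ opponent chooses; $\alpha^*$ opponent decides before each round whether to continue or stop ($Q$ must hold after every finite number of rounds, including zero); $\{x'=f(x)\ \&\ D\}$ follows the ODE for a nonnegative duration chosen by the opponent with $D$ true throughout; the notation $\{x'=f(x)\ \&\ P\wedge(Q_1\cup Q_2)\}$ abbreviates $\{x'=f(x)\ \&\ P\wedge Q_1\}\cup\{x'=f(x)\ \&\ P\wedge Q_2\}$; $\alpha^d$ swaps roles: inside, the ownship makes all choices and a failed test makes the ownship lose. $\mathit{adv}:=(\dots)$ is a bookkeeping assignment to a variable not occurring elsewhere. Interpretation: $r,h$ horizontal/vertical separation, $v$ relative vertical velocity, $r_v$ closure rate, $a_o$ ownship vertical acceleration, advisory $(w,v_{lo},v_{up})$ with lower/upper target climb rates, $a_{up}$ upper acceleration bound, $t$ timer, $\epsilon$ time bound ($\epsilon<0$ encodes unbounded time). Safe regions: $T_{lo}(v,w,v_{lo})\equiv\frac{\max(0,w(v_{lo}-v))}{a_{lo}}$, $T_{up}(v,w,v_{up})\equiv\frac{\max(0,w(v_{up}-v))}{a_{up}}$; $A_{lo}(v,w,v_{lo},h_n,t)\equiv(0\le t<T_{lo}\wedge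 h_n=\frac{wa_{lo}}2t^2+vt)\vee(t\ge T_{lo}\wedge h_n=v_{lo}t-\frac{w\max(0,w(v_{lo}-v))^2}{2a_{lo}})$; $A_{up}(v,w,v_{up},h_n,t)\equiv(0\le t<T_{up}\wedge h_n=\frac{wa_{up}}2t^2+vt)\vee(t\ge T_{up}\wedge h_n=w\max(wv_{up},wv)t-\frac{w\max(0,w(v_{up}-v))^2}{2a_{up}})$; $L^{\epsilon}_{impl}(r,h,v,w,v_{lo})\equiv\forall t\,\forall r_n\,\forall h_n((t\le\epsilon\vee\epsilon<0)\wedge r_n=r_vt\wedge A_{lo}(v,w,v_{lo},h_n,t)\to(|r-r_n|>r_p\vee w(h_n-h)>h_p))$; $U^{\epsilon}_{impl}(r,h,v,w,v_{up})\equiv\forall t\,\forall r_n\,\forall h_n((t\le\epsilon\vee\epsilon<0)\wedge r_n=r_vt\wedge A_{up}(v,w,v_{up},h_n,t)\to(|r-r_n|>r_p\vee w(h-h_n)>h_p))$; $C^{\epsilon}_{impl}(r,h,v,w,v_{lo},v_{up})\equiv wv_{lo}\le wv_{up}\wedge(L^{\epsilon}_{impl}(r,h,v,w,v_{lo})\vee U^{\epsilon}_{impl}(r,h,v,w,v_{up}))$. (Quantified variables $t,r_n,h_n$ are bound; $r_v,a_{lo},a_{up},r_p,h_p,\epsilon$ are the parameters.) *)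

theory Defs
  imports Complex_Main
begin

text \<open>
  Differential game logic.  Terms and formulas are represented by their meaning on states;
  hybrid games are syntactic.  Outside any dual, all choices are made by the opponent and a failed
  test loses for the opponent; under an odd number of duals the roles are exchanged.
\<close>

type_synonym 'v state = "'v \<Rightarrow> real"
type_synonym 'v trm = "'v state \<Rightarrow> real"
type_synonym 'v fml = "'v state \<Rightarrow> bool"

datatype 'v game =
    Assign 'v "'v trm"                        (infix "::=" 78)
  | AssignAny 'v                              ("_ ::= *" [79] 78)
  | Test "'v fml"                             ("\<questiondown> _" [78] 78)
  | Evolve "'v \<rightharpoonup> 'v trm" "'v fml"
  | Seq "'v game" "'v game"                   (infixr ";;" 75)
  | Choice "'v game" "'v game"                (infixr "\<squnion>" 77)
  | Loop "'v game"
  | Dual "'v game"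

text \<open>
  \<open>evolves f D s d s'\<close>: some solution of \<open>x' = f\<close> of duration \<open>d\<close> leads from \<open>s\<close> to \<open>s'\<close> and
  satisfies \<open>D\<close> throughout, including at both end points.  Variables without a differential
  equation stay constant.
\<close>

definition evolves ::
  "('v \<rightharpoonup> 'v trm) \<Rightarrow> 'v fml \<Rightarrow> 'v state \<Rightarrow> real \<Rightarrow> 'v state \<Rightarrow> bool" where
  "evolves f D s d s' \<longleftrightarrow> 0 \<le> d \<and>
     (\<exists>\<phi>. \<phi> 0 = s \<and> \<phi> d = s' \<and>
       (\<forall>\<tau>\<in>{0..d}. D (\<phi> \<tau>) \<and>
          (\<forall>x. case f x of
                 None \<Rightarrow> \<phi> \<tau> x = s x
               | Some e \<Rightarrow>
                   ((\<lambda>\<sigma>. \<phi> \<sigma> x) has_real_derivative e (\<phi> \<tau>)) (at \<tau> within {0..d}))))"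

text \<open>
  Winning region semantics.  Both \<open>game_box \<alpha> Q\<close> and \<open>game_dia \<alpha> Q\<close> describe the states from which the
  ownship has a strategy in \<open>\<alpha>\<close> to achieve \<open>Q\<close>: in \<open>game_box\<close> the opponent makes the choices of \<open>\<alpha>\<close>,
  in \<open>game_dia\<close> the ownship does.  The one who controls a loop cannot win by never leaving it, hence the
  greatest fixed point for \<open>game_box\<close> and the least one for \<open>game_dia\<close>.
\<close>

fun game_box :: "'v game \<Rightarrow> 'v fml \<Rightarrow> 'v fml"
and game_dia :: "'v game \<Rightarrow> 'v fml \<Rightarrow> 'v fml" where
  "game_box (x ::= e) Q = (\<lambda>s. Q (s(x := e s)))"
| "game_box (x ::= *) Q = (\<lambda>s. \<forall>c. Q (s(x := c)))"
| "game_box (\<questiondown> P) Q = (\<lambda>s. P s \<longrightarrow> Q s)"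
| "game_box (Evolve f D) Q = (\<lambda>s. \<forall>d s'. evolves f D s d s' \<longrightarrow> Q s')"
| "game_box (\<alpha> ;; \<beta>) Q = game_box \<alpha> (game_box \<beta> Q)"
| "game_box (\<alpha> \<squnion> \<beta>) Q = (\<lambda>s. game_box \<alpha> Q s \<and> game_box \<beta> Q s)"
| "game_box (Loop \<alpha>) Q = gfp (\<lambda>Z s. Q s \<and> game_box \<alpha> Z s)"
| "game_box (Dual \<alpha>) Q = game_dia \<alpha> Q"
| "game_dia (x ::= e) Q = (\<lambda>s. Q (s(x := e s)))"
| "game_dia (x ::= *) Q = (\<lambda>s. \<exists>c. Q (s(x := c)))"
| "game_dia (\<questiondown> P) Q = (\<lambda>s. P s \<and> Q s)"
| "game_dia (Evolve f D) Q = (\<lambda>s. \<exists>d s'. evolves f D s d s' \<and> Q s')"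
| "game_dia (\<alpha> ;; \<beta>) Q = game_dia \<alpha> (game_dia \<beta> Q)"
| "game_dia (\<alpha> \<squnion> \<beta>) Q = (\<lambda>s. game_dia \<alpha> Q s \<or> game_dia \<beta> Q s)"
| "game_dia (Loop \<alpha>) Q = lfp (\<lambda>Z s. Q s \<or> game_dia \<alpha> Z s)"
| "game_dia (Dual \<alpha>) Q = game_box \<alpha> Q"

definition valid :: "'v fml \<Rightarrow> bool" where
  "valid P \<longleftrightarrow> (\<forall>s. P s)"

text \<open>The notation \<open>{x' = f & P \<and> (Q1 \<union> Q2)}\<close>.\<close>

definition Evolve_cup :: "('v \<rightharpoonup> 'v trm) \<Rightarrow> 'v fml \<Rightarrow> 'v fml \<Rightarrow> 'v fml \<Rightarrow> 'v game" where
  "Evolve_cup f P Q1 Q2 = Evolve f (\<lambda>s. P s \<and> Q1 s) \<squnion> Evolve f (\<lambda>s. P s \<and> Q2 s)"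


definition T_lo :: "real \<Rightarrow> real \<Rightarrow> real \<Rightarrow> real \<Rightarrow> real" where
  "T_lo alo v w vlo = max 0 (w * (vlo - v)) / alo"

definition T_up :: "real \<Rightarrow> real \<Rightarrow> real \<Rightarrow> real \<Rightarrow> real" where
  "T_up aup v w vup = max 0 (w * (vup - v)) / aup"

definition A_lo :: "real \<Rightarrow> real \<Rightarrow> real \<Rightarrow> real \<Rightarrow> real \<Rightarrow> real \<Rightarrow> bool" where
  "A_lo alo v w vlo hn t \<longleftrightarrow>
     (0 \<le> t \<and> t < T_lo alo v w vlo \<and> hn = w * alo / 2 * t\<^sup>2 + v * t) \<or>
     (t \<ge> T_lo alo v w vlo \<and> hn = vlo * t - w * (max 0 (w * (vlo - v)))\<^sup>2 / (2 * alo))"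

definition A_up :: "real \<Rightarrow> real \<Rightarrow> real \<Rightarrow> real \<Rightarrow> real \<Rightarrow> real \<Rightarrow> bool" where
  "A_up aup v w vup hn t \<longleftrightarrow>
     (0 \<le> t \<and> t < T_up aup v w vup \<and> hn = w * aup / 2 * t\<^sup>2 + v * t) \<or>
     (t \<ge> T_up aup v w vup \<and>
        hn = w * max (w * vup) (w * v) * t - w * (max 0 (w * (vup - v)))\<^sup>2 / (2 * aup))"

definition L_impl ::
  "real \<Rightarrow> real \<Rightarrow> real \<Rightarrow> real \<Rightarrow> real \<Rightarrow> real \<Rightarrow> real \<Rightarrow> real \<Rightarrow> real \<Rightarrow> real \<Rightarrow> bool" where
  "L_impl rp hp rv alo eps r h v w vlo \<longleftrightarrow>
     (\<forall>t rn hn. (t \<le> eps \<or> eps < 0) \<and> rn = rv * t \<and> A_lo alo v w vlo hn t \<longrightarrow>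
        \<bar>r - rn\<bar> > rp \<or> w * (hn - h) > hp)"

definition U_impl ::
  "real \<Rightarrow> real \<Rightarrow> real \<Rightarrow> real \<Rightarrow> real \<Rightarrow> real \<Rightarrow> real \<Rightarrow> real \<Rightarrow> real \<Rightarrow> real \<Rightarrow> bool" where
  "U_impl rp hp rv aup eps r h v w vup \<longleftrightarrow>
     (\<forall>t rn hn. (t \<le> eps \<or> eps < 0) \<and> rn = rv * t \<and> A_up aup v w vup hn t \<longrightarrow>
        \<bar>r - rn\<bar> > rp \<or> w * (h - hn) > hp)"

definition C_impl ::
  "real \<Rightarrow> real \<Rightarrow> real \<Rightarrow> real \<Rightarrow> real \<Rightarrow> real \<Rightarrow>
   real \<Rightarrow> real \<Rightarrow> real \<Rightarrow> real \<Rightarrow> real \<Rightarrow> real \<Rightarrow> bool" where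
  "C_impl rp hp rv alo aup eps r h v w vlo vup \<longleftrightarrow>
     w * vlo \<le> w * vup \<and>
     (L_impl rp hp rv alo eps r h v w vlo \<or> U_impl rp hp rv aup eps r h v w vup)"

text \<open>
  States are real-valued, so the triple-valued variable \<open>adv\<close> is represented by its three
  components; none of them is read anywhere.
\<close>

datatype var = Xr | Xh | Xv | Xw | Xvlo | Xvup | Xao | Xt | Xadv_w | Xadv_lo | Xadv_up

definition alpha4 ::
  "real \<Rightarrow> real \<Rightarrow> real \<Rightarrow> real \<Rightarrow> real \<Rightarrow> real \<Rightarrow> real \<Rightarrow> var game" where
  "alpha4 rp hp rv alo aup amax eps =
     (Xw ::= (\<lambda>_. 1) \<squnion> Xw ::= (\<lambda>_. - 1)) ;;
     Xvlo ::= * ;;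
     Xvup ::= * ;;
     \<questiondown> (\<lambda>s. C_impl rp hp rv alo aup eps (s Xr) (s Xh) (s Xv) (s Xw) (s Xvlo) (s Xvup)) ;;
     (Xadv_w ::= (\<lambda>s. s Xw) ;; Xadv_lo ::= (\<lambda>s. s Xvlo) ;; Xadv_up ::= (\<lambda>s. s Xvup)) ;;
     Xt ::= (\<lambda>_. 0) ;;
     Loop (
       Dual (Xao ::= * ;; \<questiondown> (\<lambda>s. - amax \<le> s Xao \<and> s Xao \<le> amax)) ;;
       Evolve_cup
         [Xr \<mapsto> (\<lambda>_. - rv), Xh \<mapsto> (\<lambda>s. - s Xv), Xv \<mapsto> (\<lambda>s. s Xao), Xt \<mapsto> (\<lambda>_. 1)]
         (\<lambda>s. s Xt \<le> eps \<or> eps < 0)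
         (\<lambda>s. s Xw * s Xao \<le> 0 \<or> s Xw * s Xv \<le> s Xw * s Xvup)
         (\<lambda>s. s Xw * s Xao \<ge> 0 \<and> s Xw * s Xv \<ge> s Xw * s Xvup))"

end

theory Submission
  imports Defs
begin

text \<open>
  A new advisory is tested against \<open>C_impl\<close> before it is followed, so the outer loop keeps the
  postcondition as its invariant and only the inner loop needs work.  There the ownship fixes once
  and for all whether the lower or the upper bound makes the advisory safe.  In the first case it
  always accelerates with \<open>w * alo\<close> and in the second case it always coasts: both keep it on
  the safe side of the nominal trajectory, and the nominal trajectory recomputed from any later state
  is no less favourable than the rest of the old one.
\<close>

section \<open>Nominal climb profiles as one signed formula\<close>

text \<open>
  The distance covered with initial velocity \<open>p\<close> and acceleration \<open>a\<close> until the velocity \<open>q\<close> is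
  reached; for \<open>p > q\<close> the velocity is \<open>q\<close> from the start, as in \<open>A_lo\<close>.  The last square merges
  the two phases of \<open>A_lo\<close> into one formula.
\<close>

definition climb :: "real \<Rightarrow> real \<Rightarrow> real \<Rightarrow> real \<Rightarrow> real" where
  "climb a p q t = q * t - ((max 0 (q - p))\<^sup>2 - (max 0 (q - p - a * t))\<^sup>2) / (2 * a)"

lemma climb_0 [simp]: "climb a p q 0 = 0"
  by (simp add: climb_def)

lemma climb_before:
  assumes "a > 0" "t \<ge> 0" "t \<le> (q - p) / a"
  shows "climb a p q t = a / 2 * t\<^sup>2 + p * t"
proof -
  have "a * t \<le> q - p" "0 \<le> a * t"
    using assms by (simp_all add: field_simps)
  then have "p \<le> q" and "q - p - a * t \<ge> 0" by linarith+
  then show ?thesis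
    using assms(1) by (simp add: climb_def field_simps power2_eq_square)
qed

lemma climb_after:
  assumes "a > 0" "t \<ge> max 0 (q - p) / a"
  shows "climb a p q t = q * t - (max 0 (q - p))\<^sup>2 / (2 * a)"
proof -
  have "q - p - a * t \<le> 0"
    using assms by (simp add: field_simps max_def split: if_splits)
  then show ?thesis
    by (simp add: climb_def)
qed

text \<open>Since \<open>w * w = 1\<close>, multiplying by \<open>w\<close> turns a downward
  advisory into an upward one, so one profile serves both. In the second phase
  \<open>t \<ge> 0\<close> holds because the switching time is nonnegative.\<close>

lemma A_lo_iff_climb:
  assumes "alo > 0" "w = - 1 \<or> w = 1"
  shows "A_lo alo v w vlo hn t \<longleftrightarrow> t \<ge> 0 \<and> w * hn = climb alo (w * v) (w * vlo) t"
proof -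
  let ?T = "max 0 (w * vlo - w * v) / alo"
  have T: "T_lo alo v w vlo = ?T" "?T \<ge> 0"
    using assms(1) by (simp_all add: T_lo_def algebra_simps)
  show ?thesis
  proof (cases "t < ?T")
    case True
    have "climb alo (w * v) (w * vlo) t = alo / 2 * t\<^sup>2 + w * v * t" if "t \<ge> 0"
    proof (rule climb_before)
      show "t \<le> (w * vlo - w * v) / alo"
        using True that assms(1) by (auto simp: max_def split: if_splits)
    qed (use assms that in auto)
    with True assms(2) T show ?thesis
      by (auto simp: A_lo_def)
  next
    case False
    then have "t \<ge> 0" using T(2) by linarith
    with False climb_after[of alo "w * vlo" "w * v" t] assms T show ?thesis
      by (auto simp: A_lo_def algebra_simps)
  qed
qed

lemma A_up_iff_climb:
  assumes "aup > 0" "w = - 1 \<or> w = 1"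
  shows "A_up aup v w vup hn t \<longleftrightarrow>
    t \<ge> 0 \<and> w * hn = climb aup (w * v) (max (w * vup) (w * v)) t"
proof -
  let ?q = "max (w * vup) (w * v)"
  have w: "w * (w * ?q) = ?q" using assms(2) by auto
  \<comment> \<open>A bound that is already exceeded gets replaced by the current velocity. This
    leaves the switching time unchanged, so the upper profile is a lower one with target
    \<open>w * ?q\<close>.\<close>
  have "A_up aup v w vup hn t \<longleftrightarrow> A_lo aup v w (w * ?q) hn t"
  proof -
    have "max 0 (w * (w * ?q - v)) = max 0 (w * (vup - v))"
      unfolding right_diff_distrib w by simp
    then show ?thesis
      by (simp add: A_up_def A_lo_def T_up_def T_lo_def)
  qed
  also have "\<dots> \<longleftrightarrow> t \<ge> 0 \<and> w * hn = climb aup (w * v) ?q t"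
    using A_lo_iff_climb[OF assms, of v "w * ?q"] by (simp only: w)
  finally show ?thesis .
qed

section \<open>Restarting a profile after accelerating or coasting\<close>

text \<open>Below \<open>q\<close>, full acceleration is the nominal motion itself; beyond
  \<open>q\<close> it only gains on the profile, which stays at velocity \<open>q\<close>.\<close>

lemma climb_accelerate:
  assumes "a > 0" "s \<ge> 0"
  shows "climb a p q (s + u) \<le> p * s + a / 2 * s\<^sup>2 + climb a (p + a * s) q u"
proof -
  define x where "x = q - p"
  have y: "a * s \<ge> 0" using assms by simp
  \<comment> \<open>The squares at time \<open>s + u\<close> cancel in the claim; this is the rest,
    times \<open>2 * a\<close>. Splitting squares into positive and negative parts leaves only the
    negative ones to compare.\<close>
  have "x\<^sup>2 - (x - a * s)\<^sup>2 \<le> (max 0 x)\<^sup>2 - (max 0 (x - a * s))\<^sup>2"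
  proof -
    have "(min 0 x)\<^sup>2 \<le> (min 0 (x - a * s))\<^sup>2"
      by (rule abs_le_square_iff[THEN iffD1]) (use y in \<open>auto simp: min_def\<close>)
    moreover have "z\<^sup>2 = (max 0 z)\<^sup>2 + (min 0 z)\<^sup>2" for z :: real
      by (simp add: max_def min_def)
    ultimately show ?thesis by (smt (verit))
  qed
  then have "(x\<^sup>2 - (x - a * s)\<^sup>2) / (2 * a) \<le> ((max 0 x)\<^sup>2 - (max 0 (x - a * s))\<^sup>2) / (2 * a)"
    using assms(1) by (intro divide_right_mono) auto
  moreover have "(x\<^sup>2 - (x - a * s)\<^sup>2) / (2 * a) = q * s - (p * s + a / 2 * s\<^sup>2)"
    using assms(1) by (simp add: x_def field_simps power2_eq_square)
  moreover have eqs: "q - p = x" "q - (p + a * s) = x - a * s"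
    "x - (a * s + a * u) = x - a * s - a * u"
    by (simp_all add: x_def algebra_simps)
  ultimately show ?thesis
    unfolding climb_def distrib_left eqs diff_divide_distrib by linarith
qed

text \<open>For \<open>p \<le> q\<close> the profile never moves slower than \<open>p\<close>, so
  postponing it by \<open>s\<close> while coasting at \<open>p\<close> cannot gain distance.\<close>

lemma climb_coast:
  assumes "a > 0" "s \<ge> 0" "u \<ge> 0" "p \<le> q"
  shows "p * s + climb a p q u \<le> climb a p q (s + u)"
proof -
  define x where "x = q - p - a * u"
  have y: "a * s \<ge> 0" "a * u \<ge> 0" using assms by simp_all
  \<comment> \<open>The convex function \<open>(max 0 z)\<^sup>2\<close> lies above its tangent at
    \<open>x\<close>, whose slope is \<open>2 * max 0 x\<close>.\<close>
  have "(max 0 x)\<^sup>2 - (max 0 (x - a * s))\<^sup>2 \<le> 2 * (a * s) * max 0 x"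
  proof (cases "x \<ge> a * s")
    case True
    then have "(max 0 x)\<^sup>2 - (max 0 (x - a * s))\<^sup>2 = 2 * (a * s) * max 0 x - (a * s)\<^sup>2"
      using y by (simp add: power2_eq_square algebra_simps)
    then show ?thesis by simp
  next
    case False
    then have "max 0 x * max 0 x \<le> (a * s) * max 0 x"
      using y by (intro mult_right_mono) auto
    moreover have "0 \<le> (a * s) * max 0 x"
      using y by simp
    ultimately show ?thesis using False by (simp add: power2_eq_square)
  qed
  also have "\<dots> \<le> 2 * (a * s) * (q - p)"
    using y assms(4) by (intro mult_left_mono) (auto simp: x_def)
  finally have "((max 0 x)\<^sup>2 - (max 0 (x - a * s))\<^sup>2) / (2 * a) \<le> (q - p) * s"
    using assms(1) by (simp add: field_simps)
  moreover have "q - p - a * (s + u) = x - a * s" "q - p - a * u = x"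
    by (simp_all add: x_def algebra_simps)
  ultimately show ?thesis
    unfolding climb_def by (simp add: diff_divide_distrib algebra_simps)
qed

section \<open>Solving the differential equations\<close>

lemma eq_on_if_same_derivative:
  fixes f g :: "real \<Rightarrow> real"
  assumes "\<And>x. x \<in> {0..d} \<Longrightarrow> (f has_real_derivative f' x) (at x within {0..d})"
    and "\<And>x. x \<in> {0..d} \<Longrightarrow> (g has_real_derivative f' x) (at x within {0..d})"
    and "f 0 = g 0" "y \<in> {0..d}"
  shows "f y = g y"
proof (cases "y = 0")
  case False
  have D: "((\<lambda>x. f x - g x) has_real_derivative 0) (at x within {0..d})" if "x \<in> {0..d}" for x
    using DERIV_diff[OF assms(1)[OF that] assms(2)[OF that]] by simp
  have "f y - g y = f 0 - g 0"
  proof (rule DERIV_isconst_end[where f = "\<lambda>x. f x - g x"])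
    show "0 < y" using False assms(4) by simp
    show "continuous_on {0..y} (\<lambda>x. f x - g x)"
    proof (rule DERIV_continuous_on)
      show "((\<lambda>x. f x - g x) has_real_derivative 0) (at x within {0..y})" if "x \<in> {0..y}" for x
        by (rule DERIV_subset[OF D]) (use that assms(4) in auto)
    qed
    show "((\<lambda>x. f x - g x) has_real_derivative 0) (at x)" if "0 < x" "x < y" for x
    proof -
      have "((\<lambda>x. f x - g x) has_real_derivative 0) (at x within {0<..<d})"
        by (rule DERIV_subset[OF D]) (use that assms(4) in auto)
      moreover have "at x within {0<..<d} = at x"
        by (rule at_within_open) (use that assms(4) in auto)
      ultimately show ?thesis by simp
    qed
  qed
  with assms(3) show ?thesis by simp
qed (use assms(3) in simp)

text \<open>\<open>Xao\<close> has no equation and stays constant, so the system is triangular: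
  first the velocity is found to be linear, then the separation quadratic. \<open>D s'\<close> later
  supplies the time bound in \<open>track_inv\<close>.\<close>

lemma evolves_acceleration:
  assumes "evolves [Xr \<mapsto> (\<lambda>_. - rv), Xh \<mapsto> (\<lambda>s. - s Xv), Xv \<mapsto> (\<lambda>s. s Xao), Xt \<mapsto> (\<lambda>_. 1)]
    D s d s'"
  shows "d \<ge> 0" "D s'"
    "s' Xr = s Xr - rv * d" "s' Xh = s Xh - (s Xv * d + s Xao / 2 * d\<^sup>2)"
    "s' Xv = s Xv + s Xao * d" "s' Xt = s Xt + d"
    "s' Xw = s Xw" "s' Xvlo = s Xvlo" "s' Xvup = s Xvup"
proof -
  let ?f = "[Xr \<mapsto> (\<lambda>_. - rv), Xh \<mapsto> (\<lambda>s. - s Xv), Xv \<mapsto> (\<lambda>s. s Xao), Xt \<mapsto> (\<lambda>_. 1)]"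
  from assms obtain \<phi> where d: "d \<ge> 0" and \<phi>0: "\<phi> 0 = s" and \<phi>d: "\<phi> d = s'"
    and \<phi>: "\<And>\<tau>. \<tau> \<in> {0..d} \<Longrightarrow> D (\<phi> \<tau>) \<and> (\<forall>x. case ?f x of None \<Rightarrow> \<phi> \<tau> x = s x
      | Some e \<Rightarrow> ((\<lambda>\<sigma>. \<phi> \<sigma> x) has_real_derivative e (\<phi> \<tau>)) (at \<tau> within {0..d}))"
    unfolding evolves_def by blast
  have const: "\<phi> \<tau> x = s x" if "\<tau> \<in> {0..d}" "?f x = None" for \<tau> x
    using conjunct2[OF \<phi>[OF that(1)], rule_format, of x] unfolding that(2) by simp
  have deriv: "((\<lambda>\<sigma>. \<phi> \<sigma> x) has_real_derivative e (\<phi> \<tau>)) (at \<tau> within {0..d})"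
    if "\<tau> \<in> {0..d}" "?f x = Some e" for \<tau> x e
    using conjunct2[OF \<phi>[OF that(1)], rule_format, of x] unfolding that(2) by simp
  have ao: "\<phi> \<tau> Xao = s Xao" if "\<tau> \<in> {0..d}" for \<tau>
    using const[OF that, of Xao] by simp
  have v: "\<phi> \<tau> Xv = s Xv + s Xao * \<tau>" if "\<tau> \<in> {0..d}" for \<tau>
  proof (rule eq_on_if_same_derivative[OF _ _ _ that])
    show "((\<lambda>\<sigma>. \<phi> \<sigma> Xv) has_real_derivative s Xao) (at x within {0..d})" if "x \<in> {0..d}" for x
      using deriv[OF that, of Xv "\<lambda>s. s Xao"] ao[OF that] by simp
  qed (auto intro!: derivative_eq_intros simp: \<phi>0)
  have h: "\<phi> \<tau> Xh = s Xh - (s Xv * \<tau> + s Xao / 2 * \<tau>\<^sup>2)" if "\<tau> \<in> {0..d}" for \<tau>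
  proof (rule eq_on_if_same_derivative[OF _ _ _ that])
    show "((\<lambda>\<sigma>. \<phi> \<sigma> Xh) has_real_derivative - (s Xv + s Xao * x)) (at x within {0..d})"
      if "x \<in> {0..d}" for x
      using deriv[OF that, of Xh "\<lambda>s. - s Xv"] v[OF that] by simp
  qed (auto intro!: derivative_eq_intros simp: \<phi>0)
  have r: "\<phi> \<tau> Xr = s Xr - rv * \<tau>" if "\<tau> \<in> {0..d}" for \<tau>
  proof (rule eq_on_if_same_derivative[OF _ _ _ that])
    show "((\<lambda>\<sigma>. \<phi> \<sigma> Xr) has_real_derivative - rv) (at x within {0..d})" if "x \<in> {0..d}" for x
      using deriv[OF that, of Xr "\<lambda>_. - rv"] by simp
  qed (auto intro!: derivative_eq_intros simp: \<phi>0)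
  have t: "\<phi> \<tau> Xt = s Xt + \<tau>" if "\<tau> \<in> {0..d}" for \<tau>
  proof (rule eq_on_if_same_derivative[OF _ _ _ that])
    show "((\<lambda>\<sigma>. \<phi> \<sigma> Xt) has_real_derivative 1) (at x within {0..d})" if "x \<in> {0..d}" for x
      using deriv[OF that, of Xt "\<lambda>_. 1"] by simp
  qed (auto intro!: derivative_eq_intros simp: \<phi>0)
  have "d \<in> {0..d}" using d by simp
  from \<phi>[OF this] v[OF this] h[OF this] r[OF this] t[OF this]
    const[OF this, of Xw] const[OF this, of Xvlo] const[OF this, of Xvup] d
  show "d \<ge> 0" "D s'"
    "s' Xr = s Xr - rv * d" "s' Xh = s Xh - (s Xv * d + s Xao / 2 * d\<^sup>2)"
    "s' Xv = s Xv + s Xao * d" "s' Xt = s Xt + d"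
    "s' Xw = s Xw" "s' Xvlo = s Xvlo" "s' Xvup = s Xvup"
    by (simp_all add: \<phi>d)
qed

section \<open>Invariants of the inner loop\<close>

lemma box_Loop_coinduct:
  assumes "J s" "\<And>s. J s \<Longrightarrow> Q s" "\<And>s. J s \<Longrightarrow> game_box \<alpha> J s"
  shows "game_box (Loop \<alpha>) Q s"
proof -
  have "J \<le> gfp (\<lambda>Z s. Q s \<and> game_box \<alpha> Z s)"
    by (rule gfp_upperbound) (use assms(2,3) in auto)
  with assms(1) show ?thesis by auto
qed

context
  fixes rp hp rv alo aup eps :: real
begin

text \<open>\<open>L_impl\<close> restarted in the current state, with \<open>s Xt\<close> of the
  time budget already spent.\<close>

definition lo_inv :: "var state \<Rightarrow> bool" where
  "lo_inv s \<longleftrightarrow> (\<forall>u\<ge>0. s Xt + u \<le> eps \<or> eps < 0 \<longrightarrow>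
     \<bar>s Xr - rv * u\<bar> > rp \<or>
     climb alo (s Xw * s Xv) (s Xw * s Xvlo) u - s Xw * s Xh > hp)"

text \<open>The analogue for \<open>U_impl\<close>; above the upper bound, the maximum makes the
  profile a straight coasting line.\<close>

definition up_inv :: "var state \<Rightarrow> bool" where
  "up_inv s \<longleftrightarrow> (\<forall>u\<ge>0. s Xt + u \<le> eps \<or> eps < 0 \<longrightarrow>
     \<bar>s Xr - rv * u\<bar> > rp \<or>
     s Xw * s Xh - climb aup (s Xw * s Xv) (max (s Xw * s Xvup) (s Xw * s Xv)) u > hp)"

definition track_inv :: "var state \<Rightarrow> bool" where
  "track_inv s \<longleftrightarrow> (s Xw = - 1 \<or> s Xw = 1) \<and> (s Xt \<le> eps \<or> eps < 0) \<and> (lo_inv s \<or> up_inv s)"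

lemma L_impl_imp_lo_inv:
  assumes "alo > 0" "s Xw = - 1 \<or> s Xw = 1" "s Xt = 0"
    and "L_impl rp hp rv alo eps (s Xr) (s Xh) (s Xv) (s Xw) (s Xvlo)"
  shows "lo_inv s"
  unfolding lo_inv_def
proof (intro allI impI)
  fix u :: real assume u: "0 \<le> u" "s Xt + u \<le> eps \<or> eps < 0"
  let ?c = "climb alo (s Xw * s Xv) (s Xw * s Xvlo) u"
  \<comment> \<open>\<open>s Xw * ?c\<close> is the witness for the altitude \<open>hn\<close>, and
    its signed value is \<open>?c\<close> again.\<close>
  have w: "s Xw * (s Xw * ?c) = ?c" using assms(2) by auto
  with assms(1,2) u have "A_lo alo (s Xv) (s Xw) (s Xvlo) (s Xw * ?c) u"
    by (simp add: A_lo_iff_climb)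
  with assms(3,4) u have "\<bar>s Xr - rv * u\<bar> > rp \<or> s Xw * (s Xw * ?c - s Xh) > hp"
    unfolding L_impl_def by auto
  then show "\<bar>s Xr - rv * u\<bar> > rp \<or> ?c - s Xw * s Xh > hp"
    by (simp only: right_diff_distrib w)
qed

lemma U_impl_imp_up_inv:
  assumes "aup > 0" "s Xw = - 1 \<or> s Xw = 1" "s Xt = 0"
    and "U_impl rp hp rv aup eps (s Xr) (s Xh) (s Xv) (s Xw) (s Xvup)"
  shows "up_inv s"
  unfolding up_inv_def
proof (intro allI impI)
  fix u :: real assume u: "0 \<le> u" "s Xt + u \<le> eps \<or> eps < 0"
  let ?c = "climb aup (s Xw * s Xv) (max (s Xw * s Xvup) (s Xw * s Xv)) u"
  have w: "s Xw * (s Xw * ?c) = ?c" using assms(2) by auto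
  with assms(1,2) u have "A_up aup (s Xv) (s Xw) (s Xvup) (s Xw * ?c) u"
    by (simp add: A_up_iff_climb)
  with assms(3,4) u have "\<bar>s Xr - rv * u\<bar> > rp \<or> s Xw * (s Xh - s Xw * ?c) > hp"
    unfolding U_impl_def by auto
  then show "\<bar>s Xr - rv * u\<bar> > rp \<or> s Xw * s Xh - ?c > hp"
    by (simp only: right_diff_distrib w)
qed

lemma C_impl_imp_track_inv:
  assumes "alo > 0" "aup > 0" "s Xw = - 1 \<or> s Xw = 1" "s Xt = 0"
    and "C_impl rp hp rv alo aup eps (s Xr) (s Xh) (s Xv) (s Xw) (s Xvlo) (s Xvup)"
  shows "track_inv s"
  using assms L_impl_imp_lo_inv[of s] U_impl_imp_up_inv[of s]
  by (auto simp: track_inv_def C_impl_def)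

text \<open>The time bound in \<open>track_inv\<close> admits \<open>u = 0\<close>, where the
  profile vanishes and \<open>s Xw * s Xh\<close> or its negative exceeds \<open>hp\<close>, unless
  already \<open>\<bar>s Xr\<bar> > rp\<close>.\<close>

lemma track_inv_safe:
  assumes "track_inv s"
  shows "\<bar>s Xr\<bar> > rp \<or> \<bar>s Xh\<bar> > hp"
proof -
  have "s Xw * s Xh \<le> \<bar>s Xh\<bar>" "- (s Xw * s Xh) \<le> \<bar>s Xh\<bar>"
    using assms by (auto simp: track_inv_def)
  with assms show ?thesis
    unfolding track_inv_def lo_inv_def up_inv_def by (force dest: spec[of _ 0])
qed

context
  fixes s s' :: "var state" and D :: "var fml" and d :: real
  assumes ev: "evolves [Xr \<mapsto> (\<lambda>_. - rv), Xh \<mapsto> (\<lambda>s. - s Xv), Xv \<mapsto> (\<lambda>s. s Xao), Xt \<mapsto> (\<lambda>_. 1)]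
    D s d s'"
begin

text \<open>Time \<open>u\<close> from \<open>s'\<close> is time \<open>d + u\<close> from
  \<open>s\<close>: the horizontal distances agree, and \<open>climb_accelerate\<close> compares the
  vertical ones.\<close>

lemma lo_inv_evolves:
  assumes "alo > 0" "s Xw = - 1 \<or> s Xw = 1" "lo_inv s" "s Xao = s Xw * alo"
  shows "lo_inv s'"
  unfolding lo_inv_def
proof (intro allI impI)
  note ev' = evolves_acceleration[OF ev]
  fix u :: real assume u: "0 \<le> u" "s' Xt + u \<le> eps \<or> eps < 0"
  let ?p = "s Xw * s Xv" and ?q = "s Xw * s Xvlo"
  have "\<bar>s Xr - rv * (d + u)\<bar> > rp \<or> climb alo ?p ?q (d + u) - s Xw * s Xh > hp"
    using assms(3)[unfolded lo_inv_def, rule_format, of "d + u"] u ev'(1,6) by (simp add: add.assoc)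
  moreover have "climb alo ?p ?q (d + u) \<le> ?p * d + alo / 2 * d\<^sup>2 + climb alo (?p + alo * d) ?q u"
    using assms(1) ev'(1) by (rule climb_accelerate)
  moreover have eqs: "s' Xr - rv * u = s Xr - rv * (d + u)" "s Xw * s' Xv = ?p + alo * d"
    "s Xw * s' Xh = s Xw * s Xh - (?p * d + alo / 2 * d\<^sup>2)"
    using assms(2,4) by (auto simp: ev'(3-5) algebra_simps)
  ultimately show "\<bar>s' Xr - rv * u\<bar> > rp \<or>
      climb alo (s' Xw * s' Xv) (s' Xw * s' Xvlo) u - s' Xw * s' Xh > hp"
    unfolding ev'(7-9) eqs by auto
qed

text \<open>Coasting keeps the velocity and hence the profile fixed, so \<open>climb_coast\<close>
  bounds the profile restarted after \<open>d\<close>.\<close>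

lemma up_inv_evolves:
  assumes "aup > 0" "up_inv s" "s Xao = 0"
  shows "up_inv s'"
  unfolding up_inv_def
proof (intro allI impI)
  note ev' = evolves_acceleration[OF ev]
  fix u :: real assume u: "0 \<le> u" "s' Xt + u \<le> eps \<or> eps < 0"
  let ?p = "s Xw * s Xv" and ?q = "max (s Xw * s Xvup) (s Xw * s Xv)"
  have "\<bar>s Xr - rv * (d + u)\<bar> > rp \<or> s Xw * s Xh - climb aup ?p ?q (d + u) > hp"
    using assms(2)[unfolded up_inv_def, rule_format, of "d + u"] u ev'(1,6) by (simp add: add.assoc)
  moreover have "?p * d + climb aup ?p ?q u \<le> climb aup ?p ?q (d + u)"
    using assms(1) ev'(1) u(1) by (intro climb_coast) auto
  moreover have eqs: "s' Xr - rv * u = s Xr - rv * (d + u)" "s' Xv = s Xv"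
    "s Xw * s' Xh = s Xw * s Xh - ?p * d"
    using assms(3) by (simp_all add: ev'(3-5) algebra_simps)
  ultimately show "\<bar>s' Xr - rv * u\<bar> > rp \<or>
      s' Xw * s' Xh - climb aup (s' Xw * s' Xv) (max (s' Xw * s' Xvup) (s' Xw * s' Xv)) u > hp"
    unfolding ev'(7-9) eqs by auto
qed

end

lemma track_inv_round:
  assumes "alo > 0" "aup > 0" "amax \<ge> alo" "track_inv s"
  shows "game_box
    (Dual (Xao ::= * ;; \<questiondown> (\<lambda>s. - amax \<le> s Xao \<and> s Xao \<le> amax)) ;;
     Evolve_cup
       [Xr \<mapsto> (\<lambda>_. - rv), Xh \<mapsto> (\<lambda>s. - s Xv), Xv \<mapsto> (\<lambda>s. s Xao), Xt \<mapsto> (\<lambda>_. 1)]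
       (\<lambda>s. s Xt \<le> eps \<or> eps < 0) Q1 Q2) track_inv s"
proof -
  have w: "s Xw = - 1 \<or> s Xw = 1"
    using assms(4) by (simp add: track_inv_def)
  \<comment> \<open>The opponent picks the branch of \<open>Evolve_cup\<close> after the
    acceleration is fixed, so one \<open>a\<close> must work for every \<open>D\<close>.\<close>
  have "\<exists>a. - amax \<le> a \<and> a \<le> amax \<and> (\<forall>D d s'.
    evolves [Xr \<mapsto> (\<lambda>_. - rv), Xh \<mapsto> (\<lambda>s. - s Xv), Xv \<mapsto> (\<lambda>s. s Xao), Xt \<mapsto> (\<lambda>_. 1)]
      (\<lambda>s. (s Xt \<le> eps \<or> eps < 0) \<and> D s) (s(Xao := a)) d s' \<longrightarrow> track_inv s')"
    (is "\<exists>a. _ \<and> _ \<and> (\<forall>D d s'. ?ev D a d s' \<longrightarrow> _)")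
  proof (cases "lo_inv s")
    case True
    have "track_inv s'" if "?ev D (s Xw * alo) d s'" for D d s'
    proof -
      have "lo_inv s'"
        \<comment> \<open>\<open>lo_inv\<close> does not read \<open>Xao\<close>, so it survives the
          assignment.\<close>
        by (rule lo_inv_evolves[OF that]) (use assms(1) w True in \<open>auto simp: lo_inv_def\<close>)
      with evolves_acceleration[OF that] w show ?thesis
        by (simp add: track_inv_def)
    qed
    then show ?thesis
      by (intro exI[of _ "s Xw * alo"]) (use w assms in auto)
  next
    case False
    with assms(4) have "up_inv s" by (simp add: track_inv_def)
    have "track_inv s'" if "?ev D 0 d s'" for D d s'
    proof -
      have "up_inv s'"
        by (rule up_inv_evolves[OF that]) (use assms(2) \<open>up_inv s\<close> in \<open>auto simp: up_inv_def\<close>)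
      with evolves_acceleration[OF that] w show ?thesis
        by (simp add: track_inv_def)
    qed
    then show ?thesis
      by (intro exI[of _ 0]) (use assms in auto)
  qed
  then show ?thesis
    by (auto simp: Evolve_cup_def)
qed

end

section \<open>The two loops combined\<close>

lemma box_alpha4:
  assumes "alo > 0" "aup > 0" "amax \<ge> alo"
  shows "game_box (alpha4 rp hp rv alo aup amax eps) (\<lambda>s. \<bar>s Xr\<bar> > rp \<or> \<bar>s Xh\<bar> > hp) s"
proof -
  have loop: "game_box (Loop
      (Dual (Xao ::= * ;; \<questiondown> (\<lambda>s. - amax \<le> s Xao \<and> s Xao \<le> amax)) ;;
       Evolve_cup
         [Xr \<mapsto> (\<lambda>_. - rv), Xh \<mapsto> (\<lambda>s. - s Xv), Xv \<mapsto> (\<lambda>s. s Xao), Xt \<mapsto> (\<lambda>_. 1)]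
         (\<lambda>s. s Xt \<le> eps \<or> eps < 0) Q1 Q2)) (\<lambda>s. \<bar>s Xr\<bar> > rp \<or> \<bar>s Xh\<bar> > hp) s'"
    if "s' Xw = - 1 \<or> s' Xw = 1" "s' Xt = 0"
      "C_impl rp hp rv alo aup eps (s' Xr) (s' Xh) (s' Xv) (s' Xw) (s' Xvlo) (s' Xvup)" for s' Q1 Q2
  proof (rule box_Loop_coinduct)
    show "track_inv rp hp rv alo aup eps s'"
      by (rule C_impl_imp_track_inv[OF assms(1,2) that])
  qed (rule track_inv_safe, assumption, rule track_inv_round[OF assms])
  show ?thesis
    \<comment> \<open>The deleted rule would unfold the loop to its fixed point before
      \<open>loop\<close> could apply.\<close>
    by (simp add: alpha4_def loop del: game_box.simps(7))
qed

theorem theorem6p3: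
  fixes rp hp rv alo aup amax eps :: real
  shows "valid (\<lambda>s.
    rp \<ge> 0 \<and> hp > 0 \<and> rv \<ge> 0 \<and> alo > 0 \<and> (s Xw = - 1 \<or> s Xw = 1) \<and>
    aup > alo \<and> amax \<ge> alo \<and>
    C_impl rp hp rv alo aup eps (s Xr) (s Xh) (s Xv) (s Xw) (s Xvlo) (s Xvup) \<longrightarrow>
    game_box (Loop (alpha4 rp hp rv alo aup amax eps))
        (\<lambda>s. \<bar>s Xr\<bar> > rp \<or> \<bar>s Xh\<bar> > hp) s)"
  unfolding valid_def
proof (intro allI impI; elim conjE)
  fix s :: "var state"
  assume a: "alo > 0" "aup > alo" "amax \<ge> alo" and w: "s Xw = - 1 \<or> s Xw = 1"
    and C: "C_impl rp hp rv alo aup eps (s Xr) (s Xh) (s Xv) (s Xw) (s Xvlo) (s Xvup)"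
  let ?Q = "\<lambda>s. \<bar>s Xr\<bar> > rp \<or> \<bar>s Xh\<bar> > hp"
  \<comment> \<open>For zero rounds the initial state itself must be safe. Its clock is arbitrary;
    resetting it affects neither \<open>C_impl\<close> nor the postcondition.\<close>
  have "track_inv rp hp rv alo aup eps (s(Xt := 0))"
    by (rule C_impl_imp_track_inv) (use a w C in auto)
  from track_inv_safe[OF this] have "?Q s" by simp
  then show "game_box (Loop (alpha4 rp hp rv alo aup amax eps)) ?Q s"
  proof (rule box_Loop_coinduct[where J = ?Q])
    show "game_box (alpha4 rp hp rv alo aup amax eps) ?Q s'" for s'
      by (rule box_alpha4) (use a in auto)
  qed
qed

end
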